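(* Suppose that for all nonnegative integers $n$ and $k$ we have $S_n^k(1324)\le S_{n+1}^k(1324)$. Then the Stanley–Wilf limit of $1324$ satisfies $L(1324)\le e^{\pi\sqrt{2/3}}$.
   Context: A permutation $\pi=\pi_1\cdots\pi_n$ of $\{1,\dots,n\}$ contains a permutation (pattern) $\tau$ of length $\ell$ if there are indices $i_1<\cdots<i_\ell$ such that $\pi_{i_1}\cdots\pi_{i_\ell}$ is order-isomorphic to $\tau$; otherwise $\pi$ avoids $\tau$. An inversion in $\pi$ is a pair $(i,j)$ with $1\le i<j\le n$ and $\pi_i>\pi_j$. Let $S_n(\tau)$ denote the number of permutations of length $n$ avoiding $\tau$, and $S_n^k(\tau)$ the number of permutations of length $n$ avoiding $\tau$ that have exactly $k$ inversions. The Stanley–Wilf limit of $\tau$ is $L(\tau)=\lim_{n\to\infty} S_n(\tau)^{1/n}$ (this limit is known to exist and be finite for every pattern $\tau$). Numerically, $e^{\pi\sqrt{2/3}}\simeq 13.001954$. *)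

theory Defs
  imports Complex_Main "HOL-Combinatorics.Multiset_Permutations"
begin

text \<open>
  A permutation of \<open>{1..n}\<close> is represented by its one-line notation, i.e. an element of
  \<^term>\<open>permutations_of_set {1..n}\<close>. Positions are counted from 0, following the list library.
\<close>

definition order_isomorphic :: "nat list \<Rightarrow> nat list \<Rightarrow> bool" where
  "order_isomorphic xs ys \<longleftrightarrow>
     length xs = length ys \<and>
     (\<forall>i<length xs. \<forall>j<length xs. xs ! i < xs ! j \<longleftrightarrow> ys ! i < ys ! j)"

definition contains_pattern :: "nat list \<Rightarrow> nat list \<Rightarrow> bool" where
  "contains_pattern p \<tau> \<longleftrightarrow>
     (\<exists>is. sorted_wrt (<) is \<and> set is \<subseteq> {..<length p} \<and>
           order_isomorphic (map (\<lambda>i. p ! i) is) \<tau>)"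

definition inversions :: "nat list \<Rightarrow> (nat \<times> nat) set" where
  "inversions p = {(i, j). i < j \<and> j < length p \<and> p ! i > p ! j}"

definition avoiders :: "nat list \<Rightarrow> nat \<Rightarrow> nat list set" where
  "avoiders \<tau> n = {p \<in> permutations_of_set {1..n}. \<not> contains_pattern p \<tau>}"

definition num_avoiders :: "nat list \<Rightarrow> nat \<Rightarrow> nat" where
  "num_avoiders \<tau> n = card (avoiders \<tau> n)"

definition num_avoiders_inv :: "nat list \<Rightarrow> nat \<Rightarrow> nat \<Rightarrow> nat" where
  "num_avoiders_inv \<tau> n k = card {p \<in> avoiders \<tau> n. card (inversions p) = k}"

text \<open>
  As always with \<^const>\<open>lim\<close>, the value is meaningful only if the sequence converges; any
  nontrivial bound on it requires proving convergence first.
\<close>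

definition stanley_wilf_limit :: "nat list \<Rightarrow> real" where
  "stanley_wilf_limit \<tau> = lim (\<lambda>n. root n (real (num_avoiders \<tau> n)))"

end

theory Submission
  imports Defs "HOL-Analysis.Gamma_Function" "HOL-Real_Asymp.Real_Asymp"
begin

text \<open>
  The hypothesis lets the length grow while the number \<open>k\<close> of inversions stays fixed, and a
  permutation that is long compared with \<open>k\<close> has a rigid shape. Each inversion involves two
  positions, so in length greater than \<open>2k\<close> some entry \<open>x\<close> is involved in no inversion: everything
  to its left is smaller and everything to its right is larger. If the permutation avoids 1324, then
  the part to the left of \<open>x\<close> avoids 132 (otherwise \<open>x\<close> serves as the 4) and the part to the right
  avoids 213 (otherwise \<open>x\<close> serves as the 1), and the inversions split between the two parts.

  The Lehmer code of a 132-avoider is weakly decreasing and determines it, so the 132-avoiders with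
  \<open>a\<close> inversions are at most as many as the partitions of \<open>a\<close>; the same holds for 213, by reversing
  and complementing. Euler's product with \<open>q = exp (-t)\<close> bounds the number of partitions of \<open>a\<close> by
  \<open>exp (a t + pi\<^sup>2 / (6 t))\<close> for every \<open>t > 0\<close> (\<open>card_decreasing_seqs_le\<close>). Hence
  the number of 1324-avoiders of length \<open>N > 2k\<close> with \<open>k\<close> inversions is at most a polynomial in \<open>N\<close>
  times \<open>exp (k t + pi\<^sup>2 / (3 t))\<close> (\<open>num_avoiders_1324_inv_le_exp\<close>).

  A permutation of length \<open>n\<close> has \<open>k \<le> n\<^sup>2 / 2\<close> inversions. Moving every such \<open>k\<close> to the length
  \<open>N = n\<^sup>2 + 1\<close> and taking the optimal \<open>t = pi sqrt (2/3) / n\<close> shows that there are at most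
  \<open>(n\<^sup>2 + 1)\<^sup>3 exp (n pi sqrt (2/3))\<close> avoiders of length \<open>n\<close>
  (\<open>num_avoiders_1324_le\<close>).

  The same estimate gives the existence of the limit. A skew sum of two 1324-avoiders avoids 1324,
  so the counts are supermultiplicative; by Fekete's argument their \<open>n\<close>-th roots converge
  to their supremum as soon as they are bounded, and along multiples of a fixed length the polynomial
  factor disappears from the bound.
\<close>

section \<open>Occurrences of the patterns in terms of positions\<close>

lemma contains_pattern_132_iff:
  "contains_pattern p [1, 3, 2] \<longleftrightarrow>
     (\<exists>a b c. a < b \<and> b < c \<and> c < length p \<and> p ! a < p ! c \<and> p ! c < p ! b)" (is "?L \<longleftrightarrow> ?R")
proof
  assume ?L
  then obtain "is" where "is": "sorted_wrt (<) is" "set is \<subseteq> {..<length p}"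
    "order_isomorphic (map (\<lambda>i. p ! i) is) [1, 3, 2]"
    unfolding contains_pattern_def by blast
  then have "length is = 3" by (simp add: order_isomorphic_def)
  then obtain a b c where abc: "is = [a, b, c]"
    by (auto simp: numeral_eq_Suc length_Suc_conv)
  show ?R
    using "is" unfolding abc order_isomorphic_def
    by (intro exI[of _ a] exI[of _ b] exI[of _ c]) (auto simp: numeral_eq_Suc All_less_Suc)
next
  assume ?R
  then obtain a b c where "a < b" "b < c" "c < length p" "p ! a < p ! c" "p ! c < p ! b"
    by blast
  then show ?L
    unfolding contains_pattern_def order_isomorphic_def
    by (intro exI[of _ "[a, b, c]"]) (auto simp: numeral_eq_Suc All_less_Suc)
qed

lemma contains_pattern_213_iff:
  "contains_pattern p [2, 1, 3] \<longleftrightarrow>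
     (\<exists>a b c. a < b \<and> b < c \<and> c < length p \<and> p ! b < p ! a \<and> p ! a < p ! c)" (is "?L \<longleftrightarrow> ?R")
proof
  assume ?L
  then obtain "is" where "is": "sorted_wrt (<) is" "set is \<subseteq> {..<length p}"
    "order_isomorphic (map (\<lambda>i. p ! i) is) [2, 1, 3]"
    unfolding contains_pattern_def by blast
  then have "length is = 3" by (simp add: order_isomorphic_def)
  then obtain a b c where abc: "is = [a, b, c]"
    by (auto simp: numeral_eq_Suc length_Suc_conv)
  show ?R
    using "is" unfolding abc order_isomorphic_def
    by (intro exI[of _ a] exI[of _ b] exI[of _ c]) (auto simp: numeral_eq_Suc All_less_Suc)
next
  assume ?R
  then obtain a b c where "a < b" "b < c" "c < length p" "p ! b < p ! a" "p ! a < p ! c"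
    by blast
  then show ?L
    unfolding contains_pattern_def order_isomorphic_def
    by (intro exI[of _ "[a, b, c]"]) (auto simp: numeral_eq_Suc All_less_Suc)
qed

lemma contains_pattern_1324_iff:
  "contains_pattern p [1, 3, 2, 4] \<longleftrightarrow>
     (\<exists>a b c d. a < b \<and> b < c \<and> c < d \<and> d < length p \<and>
        p ! a < p ! c \<and> p ! c < p ! b \<and> p ! b < p ! d)" (is "?L \<longleftrightarrow> ?R")
proof
  assume ?L
  then obtain "is" where "is": "sorted_wrt (<) is" "set is \<subseteq> {..<length p}"
    "order_isomorphic (map (\<lambda>i. p ! i) is) [1, 3, 2, 4]"
    unfolding contains_pattern_def by blast
  then have "length is = 4" by (simp add: order_isomorphic_def)
  then obtain a b c d where abcd: "is = [a, b, c, d]"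
    by (auto simp: numeral_eq_Suc length_Suc_conv)
  show ?R
    using "is" unfolding abcd order_isomorphic_def
    by (intro exI[of _ a] exI[of _ b] exI[of _ c] exI[of _ d])
      (auto simp: numeral_eq_Suc All_less_Suc)
next
  assume ?R
  then obtain a b c d where "a < b" "b < c" "c < d" "d < length p"
      "p ! a < p ! c" "p ! c < p ! b" "p ! b < p ! d"
    by blast
  then show ?L
    unfolding contains_pattern_def order_isomorphic_def
    by (intro exI[of _ "[a, b, c, d]"]) (auto simp: numeral_eq_Suc All_less_Suc)
qed

section \<open>Lehmer codes of 132-avoiding permutations\<close>

fun lehmer_code :: "nat list \<Rightarrow> nat list" where
  "lehmer_code [] = []"
| "lehmer_code (x # xs) = card {y \<in> set xs. y < x} # lehmer_code xs"

lemma length_lehmer_code [simp]: "length (lehmer_code xs) = length xs"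
  by (induction xs) auto

lemma inversions_Cons:
  "inversions (x # xs) =
     (\<lambda>j. (0, Suc j)) ` {j. j < length xs \<and> xs ! j < x} \<union> map_prod Suc Suc ` inversions xs"
proof -
  have "(i, j) \<in> inversions (x # xs) \<longleftrightarrow>
    (i, j) \<in> (\<lambda>j. (0, Suc j)) ` {j. j < length xs \<and> xs ! j < x} \<union> map_prod Suc Suc ` inversions xs"
    for i j
    by (cases i; cases j) (auto simp: inversions_def image_iff)
  then show ?thesis by auto
qed

lemma finite_inversions [simp]: "finite (inversions p)"
  by (rule finite_subset[of _ "{..<length p} \<times> {..<length p}"]) (auto simp: inversions_def)

text \<open>
  Each code entry counts the inversions whose left member stands at that position.
\<close>

lemma card_inversions_eq_sum_lehmer_code:
  "distinct p \<Longrightarrow> card (inversions p) = sum_list (lehmer_code p)"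
proof (induction p)
  case Nil
  then show ?case by (simp add: inversions_def)
next
  case (Cons x xs)
  have "{y \<in> set xs. y < x} = (\<lambda>j. xs ! j) ` {j. j < length xs \<and> xs ! j < x}"
    by (auto simp: in_set_conv_nth)
  moreover have "inj_on (\<lambda>j. xs ! j) {j. j < length xs \<and> xs ! j < x}"
    using Cons.prems by (auto simp: inj_on_def nth_eq_iff_index_eq)
  ultimately have "card {y \<in> set xs. y < x} = card {j. j < length xs \<and> xs ! j < x}"
    by (simp add: card_image)
  moreover have "card (inversions (x # xs)) =
      card {j. j < length xs \<and> xs ! j < x} + card (inversions xs)"
    unfolding inversions_Cons
    by (subst card_Un_disjoint) (auto simp: inj_on_def intro!: arg_cong2[of _ _ _ _ "(+)"] card_image)
  ultimately show ?case using Cons by simp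
qed

text \<open>
  The first code entry is the rank of the first element within the underlying set, so it determines
  that element; the rest follows by recursion on the remaining set.
\<close>

lemma lehmer_code_inj:
  assumes "distinct p" "distinct q" "set p = set q" "lehmer_code p = lehmer_code q"
  shows "p = q"
  using assms
proof (induction p arbitrary: q)
  case Nil
  then show ?case by simp
next
  case (Cons x xs)
  then obtain y ys where q: "q = y # ys" by (cases q) auto
  have rank: "{z \<in> set xs. z < x} = {z \<in> set q. z < x}" "{z \<in> set ys. z < y} = {z \<in> set q. z < y}"
    using Cons.prems by (auto simp: q)
  have same: "card {z \<in> set q. z < x} = card {z \<in> set q. z < y}"
    using Cons.prems(4) by (simp add: q rank)
  have less: "card {z \<in> set q. z < u} < card {z \<in> set q. z < v}" if "u < v" "u \<in> set q" for u v
    using that by (intro psubset_card_mono) auto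
  have "x = y"
    using same less[of x y] less[of y x] Cons.prems(3) by (fastforce simp: q)
  moreover have "set xs = set ys"
    using Cons.prems \<open>x = y\<close> by (auto simp: q)
  ultimately show ?case
    using Cons.IH[of ys] Cons.prems by (simp add: q)
qed

lemma contains_132_Cons: "contains_pattern xs [1, 3, 2] \<Longrightarrow> contains_pattern (x # xs) [1, 3, 2]"
  unfolding contains_pattern_132_iff
proof (elim exE)
  fix a b c
  assume "a < b \<and> b < c \<and> c < length xs \<and> xs ! a < xs ! c \<and> xs ! c < xs ! b"
  then show "\<exists>a b c. a < b \<and> b < c \<and> c < length (x # xs) \<and>
      (x # xs) ! a < (x # xs) ! c \<and> (x # xs) ! c < (x # xs) ! b"
    by (intro exI[of _ "Suc a"] exI[of _ "Suc b"] exI[of _ "Suc c"]) auto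
qed

text \<open>
  Let \<open>x\<close> be followed immediately by \<open>y\<close>, and let \<open>z\<close> be a later entry below \<open>y\<close>. If \<open>z\<close> were
  above \<open>x\<close>, then \<open>x y z\<close> would be an occurrence of 132. So every entry counted at \<open>y\<close> is already
  counted at \<open>x\<close>.
\<close>

lemma lehmer_code_decreasing:
  assumes "distinct p" "\<not> contains_pattern p [1, 3, 2]"
  shows "sorted_wrt (\<ge>) (lehmer_code p)"
  using assms
proof (induction p)
  case Nil
  then show ?case by simp
next
  case (Cons x xs)
  have IH: "sorted_wrt (\<ge>) (lehmer_code xs)"
    using Cons contains_132_Cons by auto
  show ?case
  proof (cases xs)
    case Nil
    then show ?thesis by simp
  next
    case (Cons y ys)
    have "{z \<in> set ys. z < y} \<subseteq> {z \<in> set xs. z < x}"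
    proof
      fix z
      assume z: "z \<in> {z \<in> set ys. z < y}"
      then obtain l where l: "l < length ys" "ys ! l = z" by (auto simp: in_set_conv_nth)
      have "\<not> x < z"
      proof
        assume "x < z"
        then have "contains_pattern (x # xs) [1, 3, 2]"
          unfolding contains_pattern_132_iff using z l Cons
          by (intro exI[of _ 0] exI[of _ 1] exI[of _ "Suc (Suc l)"]) auto
        then show False using Cons.prems by simp
      qed
      moreover have "x \<noteq> z" using z Cons Cons.prems by auto
      ultimately show "z \<in> {z \<in> set xs. z < x}" using z Cons by auto
    qed
    then have "card {z \<in> set ys. z < y} \<le> card {z \<in> set xs. z < x}"
      by (intro card_mono) auto
    then show ?thesis using IH Cons by auto
  qed
qed

section \<open>Counting weakly decreasing sequences\<close>

text \<open>
  These are the partitions of \<open>a\<close> into at most \<open>m\<close> parts, padded with zeros to length \<open>m\<close>.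
\<close>

definition decreasing_seqs :: "nat \<Rightarrow> nat \<Rightarrow> nat list set" where
  "decreasing_seqs m a = {c. length c = m \<and> sorted_wrt (\<ge>) c \<and> sum_list c = a}"

lemma finite_decreasing_seqs [simp]: "finite (decreasing_seqs m a)"
proof (rule finite_subset)
  show "decreasing_seqs m a \<subseteq> {c. set c \<subseteq> {..a} \<and> length c = m}"
    by (auto simp: decreasing_seqs_def member_le_sum_list)
  show "finite {c. set c \<subseteq> {..a} \<and> length c = m}" by (rule finite_lists_length_eq) simp
qed

text \<open>
  The classical recursion for partitions: either the last part is zero and can be dropped, or all
  parts are positive and each can be lowered by one.
\<close>

lemma decreasing_seqs_Suc_cases:
  assumes "c \<in> decreasing_seqs (Suc m) a"
  shows "c \<in> (\<lambda>c. c @ [0]) ` decreasing_seqs m a \<or>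
    (Suc m \<le> a \<and> c \<in> map Suc ` decreasing_seqs (Suc m) (a - Suc m))"
proof (cases "0 \<in> set c")
  case True
  have c: "length c = Suc m" "sorted_wrt (\<ge>) c" "sum_list c = a"
    using assms by (auto simp: decreasing_seqs_def)
  obtain d x where d: "c = d @ [x]" using c(1) by (cases c rule: rev_cases) auto
  have "x = 0" using True c(2) by (auto simp: d sorted_wrt_append)
  moreover have "d \<in> decreasing_seqs m a"
    using c by (auto simp: d decreasing_seqs_def sorted_wrt_append \<open>x = 0\<close>)
  ultimately show ?thesis by (auto simp: d)
next
  case False
  have c: "length c = Suc m" "sorted_wrt (\<ge>) c" "sum_list c = a"
    using assms by (auto simp: decreasing_seqs_def)
  define d where "d = map (\<lambda>x. x - 1) c"
  have cd: "c = map Suc d"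
    using False unfolding d_def map_map
    by (intro map_idI[symmetric]) (metis Suc_pred comp_apply diff_Suc_1 neq0_conv One_nat_def)
  have "a = sum_list d + Suc m"
    using c(1,3) unfolding cd by (simp add: sum_list_Suc)
  moreover from this have "d \<in> decreasing_seqs (Suc m) (a - Suc m)"
    using c(1,2) by (simp add: cd decreasing_seqs_def sorted_wrt_map)
  ultimately show ?thesis by (auto simp: cd)
qed

lemma card_decreasing_seqs_Suc_le:
  "card (decreasing_seqs (Suc m) a) \<le> card (decreasing_seqs m a) +
     (if Suc m \<le> a then card (decreasing_seqs (Suc m) (a - Suc m)) else 0)"
proof -
  let ?U = "(\<lambda>c. c @ [0]) ` decreasing_seqs m a"
  let ?V = "if Suc m \<le> a then map Suc ` decreasing_seqs (Suc m) (a - Suc m) else {}"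
  have "card (decreasing_seqs (Suc m) a) \<le> card (?U \<union> ?V)"
    using decreasing_seqs_Suc_cases by (intro card_mono) auto
  also have "\<dots> \<le> card ?U + card ?V" by (rule card_Un_le)
  also have "\<dots> \<le> card (decreasing_seqs m a) +
     (if Suc m \<le> a then card (decreasing_seqs (Suc m) (a - Suc m)) else 0)"
    by (intro add_mono) (auto intro: card_image_le)
  finally show ?thesis .
qed

text \<open>
  The right-hand side \<open>G m\<close> is the generating function of partitions into at most \<open>m\<close> parts, of which
  the left-hand side is a single term. The recursion for the counts matches the identity \<open>G (Suc m) = G m + x ^ Suc m * G (Suc m)\<close>, so the termwise bound
  passes through an induction on \<open>m\<close> and, inside it, on \<open>a\<close>.
\<close>

lemma card_decreasing_seqs_genfun:
  fixes x :: real
  assumes "0 < x" "x < 1"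
  shows "real (card (decreasing_seqs m a)) * x ^ a \<le> (\<Prod>j=1..m. 1 / (1 - x ^ j))"
proof (induction m arbitrary: a)
  case 0
  have "decreasing_seqs 0 a \<subseteq> {[]}" by (auto simp: decreasing_seqs_def)
  then have "card (decreasing_seqs 0 a) \<le> card {[] :: nat list}" by (intro card_mono) auto
  moreover have "x ^ a \<le> 1" using assms by (simp add: power_le_one)
  ultimately have "real (card (decreasing_seqs 0 a)) * x ^ a \<le> 1 * 1"
    using assms by (intro mult_mono) auto
  then show ?case by simp
next
  case (Suc m)
  define G where "G m = (\<Prod>j=1..m. 1 / (1 - x ^ j))" for m
  have lt: "x ^ Suc m < 1" using assms by (subst power_less_one_iff) auto
  have G: "G m + x ^ Suc m * G (Suc m) = G (Suc m)"
    using lt by (simp add: G_def field_simps)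
  have G0: "0 \<le> G (Suc m)"
    unfolding G_def using assms by (intro prod_nonneg) (auto simp: power_le_one)
  have "real (card (decreasing_seqs (Suc m) a)) * x ^ a \<le> G (Suc m)"
  proof (induction a rule: less_induct)
    case (less a)
    show ?case
    proof (cases "Suc m \<le> a")
      case True
      have "x ^ a = x ^ Suc m * x ^ (a - Suc m)"
        using True by (metis le_add_diff_inverse power_add)
      moreover have "real (card (decreasing_seqs (Suc m) a)) * x ^ a \<le>
          (real (card (decreasing_seqs m a)) + real (card (decreasing_seqs (Suc m) (a - Suc m)))) * x ^ a"
        using card_decreasing_seqs_Suc_le[of m a] True assms
        by (intro mult_right_mono) auto
      ultimately have "real (card (decreasing_seqs (Suc m) a)) * x ^ a \<le>
          real (card (decreasing_seqs m a)) * x ^ a +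
          x ^ Suc m * (real (card (decreasing_seqs (Suc m) (a - Suc m))) * x ^ (a - Suc m))"
        by (simp only: algebra_simps)
      also have "\<dots> \<le> G m + x ^ Suc m * G (Suc m)"
        using Suc.IH[of a] less[of "a - Suc m"] True assms
        by (intro add_mono mult_left_mono) (auto simp: G_def)
      finally show ?thesis by (simp only: G)
    next
      case False
      have "real (card (decreasing_seqs (Suc m) a)) * x ^ a \<le> real (card (decreasing_seqs m a)) * x ^ a"
        using card_decreasing_seqs_Suc_le[of m a] False assms by (intro mult_right_mono) auto
      also have "\<dots> \<le> G m" using Suc.IH[of a] by (simp add: G_def)
      also have "\<dots> \<le> G m + x ^ Suc m * G (Suc m)" using G0 assms by simp
      finally show ?thesis by (simp only: G)
    qed
  qed
  then show ?case by (simp add: G_def)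
qed

lemma sum_power_le_geometric:
  fixes r :: real
  assumes "0 \<le> r" "r < 1"
  shows "(\<Sum>j=1..m. r ^ j) \<le> r / (1 - r)"
proof -
  have "(1 - r) * (\<Sum>j=1..m. r ^ j) = r - r ^ Suc m"
  proof (induction m)
    case (Suc m)
    have "(1 - r) * (\<Sum>j=1..Suc m. r ^ j) = (1 - r) * (\<Sum>j=1..m. r ^ j) + (1 - r) * r ^ Suc m"
      by (simp add: distrib_left)
    also have "\<dots> = r - r ^ Suc (Suc m)" unfolding Suc.IH by (simp add: algebra_simps)
    finally show ?case .
  qed simp
  then have "(1 - r) * (\<Sum>j=1..m. r ^ j) \<le> r" using assms by simp
  then show ?thesis using assms by (simp add: field_simps)
qed

text \<open>
  The full geometric series has the value \<open>1 / (exp s - 1)\<close>, and \<open>exp s \<ge> 1 + s\<close>.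
\<close>

lemma sum_exp_power_le:
  fixes s :: real
  assumes "0 < s"
  shows "(\<Sum>j=1..m. exp (- s) ^ j) \<le> 1 / s"
proof -
  have "(\<Sum>j=1..m. exp (- s) ^ j) \<le> exp (- s) / (1 - exp (- s))"
    using assms by (intro sum_power_le_geometric) auto
  also have "\<dots> = 1 / (exp s - 1)"
    using assms by (simp add: exp_minus field_simps)
  also have "\<dots> \<le> 1 / s"
  proof (intro divide_left_mono)
    show "s \<le> exp s - 1" using exp_ge_add_one_self[of s] by linarith
  qed (use assms in auto)
  finally show ?thesis .
qed

text \<open>
  Expand the logarithm of each factor as \<open>\<Sum>n. q ^ (j * n) / n\<close> with \<open>q = exp (-t)\<close> and exchange the
  summations. The inner sum over \<open>j\<close> is then geometric and at most \<open>1 / (t * n)\<close>, and what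
  remains is \<open>1 / t\<close> times Euler's series \<open>\<Sum>n. 1 / n\<^sup>2 = pi\<^sup>2 / 6\<close>.
\<close>

lemma partition_product_le:
  fixes t :: real
  assumes "0 < t"
  shows "(\<Prod>j=1..m. 1 / (1 - exp (- t) ^ j)) \<le> exp (pi\<^sup>2 / (6 * t))"
proof -
  define q where "q = exp (- t)"
  have q: "0 < q" "q < 1" using assms by (auto simp: q_def)
  have qj: "0 < q ^ j" "q ^ j < 1" if "j \<in> {1..m}" for j
    using q that by (auto simp: power_less_one_iff)
  have log_series: "(\<lambda>n. (q ^ j) ^ Suc n / real (Suc n)) sums (- ln (1 - q ^ j))"
    if "j \<in> {1..m}" for j
  proof -
    have "(\<lambda>n. - ((q ^ j) ^ n) / real n) sums ln (1 - q ^ j)"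
      using ln_series'[of "- (q ^ j)"] qj[OF that] by simp
    then have "(\<lambda>n. (q ^ j) ^ n / real n) sums (- ln (1 - q ^ j))"
      using sums_minus by fastforce
    then show ?thesis by (subst sums_Suc_iff) simp
  qed
  have "(\<Sum>j=1..m. - ln (1 - q ^ j)) \<le> 1 / t * (pi\<^sup>2 / 6)"
  proof (rule sums_le)
    show "(\<lambda>n. \<Sum>j=1..m. (q ^ j) ^ Suc n / real (Suc n)) sums (\<Sum>j=1..m. - ln (1 - q ^ j))"
      by (rule sums_sum) (rule log_series)
    show "(\<lambda>n. 1 / t * (1 / (real n + 1)\<^sup>2)) sums (1 / t * (pi\<^sup>2 / 6))"
      using inverse_squares_sums by (intro sums_mult) (simp add: add_ac)
    show "(\<Sum>j=1..m. (q ^ j) ^ Suc n / real (Suc n)) \<le> 1 / t * (1 / (real n + 1)\<^sup>2)" for n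
    proof -
      have "(q ^ j) ^ Suc n = exp (- (t * real (Suc n))) ^ j" for j
        unfolding q_def by (simp only: exp_of_nat_mult[symmetric]) (simp add: algebra_simps)
      then have "(\<Sum>j=1..m. (q ^ j) ^ Suc n / real (Suc n)) =
          (\<Sum>j=1..m. exp (- (t * real (Suc n))) ^ j) / real (Suc n)"
        by (simp only: sum_divide_distrib)
      also have "\<dots> \<le> (1 / (t * real (Suc n))) / real (Suc n)"
        using assms by (intro divide_right_mono sum_exp_power_le) auto
      also have "\<dots> = 1 / t * (1 / (real n + 1)\<^sup>2)"
        by (simp add: power2_eq_square add_ac)
      finally show ?thesis .
    qed
  qed
  moreover have "(\<Prod>j=1..m. 1 / (1 - q ^ j)) = exp (\<Sum>j=1..m. - ln (1 - q ^ j))"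
    unfolding exp_sum[OF finite_atLeastAtMost]
    by (rule prod.cong) (use qj in \<open>auto simp: exp_minus inverse_eq_divide\<close>)
  ultimately show ?thesis by (simp add: q_def mult.commute)
qed

lemma card_decreasing_seqs_le:
  fixes t :: real
  assumes "0 < t"
  shows "real (card (decreasing_seqs m a)) \<le> exp (real a * t + pi\<^sup>2 / (6 * t))"
proof -
  have "real (card (decreasing_seqs m a)) * exp (- t) ^ a \<le> exp (pi\<^sup>2 / (6 * t))"
    using card_decreasing_seqs_genfun[of "exp (- t)" m a] partition_product_le[OF assms, of m] assms
    by simp
  also have "exp (- t) ^ a = exp (- (real a * t))"
    by (simp only: exp_of_nat_mult[symmetric]) simp
  finally show ?thesis
    by (simp add: exp_add exp_minus field_simps)
qed

section \<open>Avoiders of 132 and of 213 by inversions\<close>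

definition avoiders_132_inv :: "nat set \<Rightarrow> nat \<Rightarrow> nat list set" where
  "avoiders_132_inv A a =
     {p \<in> permutations_of_set A. \<not> contains_pattern p [1, 3, 2] \<and> card (inversions p) = a}"

definition avoiders_213_inv :: "nat set \<Rightarrow> nat \<Rightarrow> nat list set" where
  "avoiders_213_inv A a =
     {p \<in> permutations_of_set A. \<not> contains_pattern p [2, 1, 3] \<and> card (inversions p) = a}"

lemma finite_avoiders_132_inv [simp]: "finite (avoiders_132_inv A a)"
  by (simp add: avoiders_132_inv_def)

lemma finite_avoiders_213_inv [simp]: "finite (avoiders_213_inv A a)"
  by (simp add: avoiders_213_inv_def)

lemma card_avoiders_132_inv_le:
  "card (avoiders_132_inv A a) \<le> card (decreasing_seqs (card A) a)"
proof (rule card_inj_on_le)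
  show "inj_on lehmer_code (avoiders_132_inv A a)"
    by (auto simp: inj_on_def avoiders_132_inv_def permutations_of_set_def intro: lehmer_code_inj)
  show "lehmer_code ` avoiders_132_inv A a \<subseteq> decreasing_seqs (card A) a"
    by (auto simp: avoiders_132_inv_def permutations_of_set_def decreasing_seqs_def
        card_inversions_eq_sum_lehmer_code lehmer_code_decreasing distinct_card)
qed simp

text \<open>
  Reversal followed by complementation in \<open>{..M}\<close> turns 213 into 132 and preserves the number of
  inversions, since it reverses both the order of the positions and the order of the values.
\<close>

lemma card_avoiders_213_inv_le:
  assumes "finite A"
  shows "card (avoiders_213_inv A a) \<le> card (decreasing_seqs (card A) a)"
proof -
  obtain M where M: "A \<subseteq> {..M}" using assms finite_nat_iff_bounded_le by blast
  define rc where "rc p = rev (map (\<lambda>v. M - v) p)" for p :: "nat list"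
  have inj_compl: "inj_on (\<lambda>v. M - v) A" 
  proof (rule inj_onI)
    fix x y assume "x \<in> A" "y \<in> A" "M - x = M - y"
    then show "x = y" using M by (metis atMost_iff diff_diff_cancel subsetD)
  qed
  have len: "length (rc p) = length p" for p by (simp add: rc_def)
  have less_iff: "rc p ! i < rc p ! j \<longleftrightarrow> p ! (length p - Suc j) < p ! (length p - Suc i)"
    if "set p = A" "i < length p" "j < length p" for p i j
  proof -
    have "p ! (length p - Suc i) \<in> A" "p ! (length p - Suc j) \<in> A"
      using that by (auto intro!: nth_mem)
    then have "p ! (length p - Suc i) \<le> M" "p ! (length p - Suc j) \<le> M" using M by auto
    then show ?thesis using that by (auto simp: rc_def rev_nth)
  qed
  have "card (avoiders_213_inv A a) \<le> card (avoiders_132_inv ((\<lambda>v. M - v) ` A) a)"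
  proof (rule card_inj_on_le)
    show "inj_on rc (avoiders_213_inv A a)"
    proof (rule inj_onI)
      fix p q assume "p \<in> avoiders_213_inv A a" "q \<in> avoiders_213_inv A a" "rc p = rc q"
      then show "p = q"
        using inj_compl by (intro map_inj_on[of "\<lambda>v. M - v" p q])
          (auto simp: rc_def avoiders_213_inv_def permutations_of_set_def)
    qed
    show "rc ` avoiders_213_inv A a \<subseteq> avoiders_132_inv ((\<lambda>v. M - v) ` A) a"
    proof (intro image_subsetI)
      fix p assume "p \<in> avoiders_213_inv A a"
      then have p: "set p = A" "distinct p" "\<not> contains_pattern p [2, 1, 3]" "card (inversions p) = a"
        by (auto simp: avoiders_213_inv_def permutations_of_set_def)
      have "bij_betw (\<lambda>(i, j). (length p - Suc j, length p - Suc i)) (inversions (rc p)) (inversions p)"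
        by (rule bij_betwI[where g = "\<lambda>(i, j). (length p - Suc j, length p - Suc i)"])
          (auto simp: inversions_def len less_iff[OF p(1)])
      then have "card (inversions (rc p)) = a" using p(4) bij_betw_same_card by metis
      moreover have "\<not> contains_pattern (rc p) [1, 3, 2]"
      proof
        assume "contains_pattern (rc p) [1, 3, 2]"
        then obtain b c d where "b < c" "c < d" "d < length p" "rc p ! b < rc p ! d" "rc p ! d < rc p ! c"
          unfolding contains_pattern_132_iff len by blast
        then have "contains_pattern p [2, 1, 3]"
          unfolding contains_pattern_213_iff using less_iff[OF p(1)]
          by (intro exI[of _ "length p - Suc d"] exI[of _ "length p - Suc c"] exI[of _ "length p - Suc b"])
            auto
        then show False using p by simp
      qed
      moreover have "rc p \<in> permutations_of_set ((\<lambda>v. M - v) ` A)"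
        using p inj_compl by (auto simp: permutations_of_set_def rc_def distinct_map)
      ultimately show "rc p \<in> avoiders_132_inv ((\<lambda>v. M - v) ` A) a"
        by (simp add: avoiders_132_inv_def)
    qed
  qed simp
  also have "\<dots> \<le> card (decreasing_seqs (card A) a)"
    using card_avoiders_132_inv_le[of "(\<lambda>v. M - v) ` A" a] inj_compl by (simp add: card_image)
  finally show ?thesis .
qed

section \<open>Decomposition of 1324-avoiders with few inversions\<close>

lemma sum_lehmer_code_append:
  assumes "\<And>x y. x \<in> set xs \<Longrightarrow> y \<in> set ys \<Longrightarrow> x < y"
  shows "sum_list (lehmer_code (xs @ ys)) = sum_list (lehmer_code xs) + sum_list (lehmer_code ys)"
  using assms
proof (induction xs)
  case (Cons x xs)
  have "{y \<in> set (xs @ ys). y < x} = {y \<in> set xs. y < x}"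
    using Cons.prems by (fastforce simp: not_less_iff_gr_or_eq)
  then show ?case using Cons by simp
qed simp

lemma card_inversions_direct_sum:
  assumes "distinct (xs @ x # ys)" "\<And>v. v \<in> set xs \<Longrightarrow> v < x" "\<And>v. v \<in> set ys \<Longrightarrow> x < v"
  shows "card (inversions (xs @ x # ys)) = card (inversions xs) + card (inversions ys)"
proof -
  have "{y \<in> set ys. y < x} = {}" using assms(3) by fastforce
  then have "sum_list (lehmer_code (x # ys)) = sum_list (lehmer_code ys)" by simp
  moreover have "sum_list (lehmer_code (xs @ x # ys)) =
      sum_list (lehmer_code xs) + sum_list (lehmer_code (x # ys))"
    using assms by (intro sum_lehmer_code_append) (auto intro: less_trans)
  ultimately show ?thesis
    using assms(1) by (simp add: card_inversions_eq_sum_lehmer_code)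
qed

lemma contains_1324_if_prefix_132:
  assumes "contains_pattern xs [1, 3, 2]" "\<And>v. v \<in> set xs \<Longrightarrow> v < x"
  shows "contains_pattern (xs @ x # ys) [1, 3, 2, 4]"
proof -
  obtain a b c where "a < b" "b < c" "c < length xs" "xs ! a < xs ! c" "xs ! c < xs ! b"
    using assms(1) unfolding contains_pattern_132_iff by blast
  then show ?thesis
    unfolding contains_pattern_1324_iff using assms(2)
    by (intro exI[of _ a] exI[of _ b] exI[of _ c] exI[of _ "length xs"]) (auto simp: nth_append)
qed

lemma contains_1324_if_suffix_213:
  assumes "contains_pattern ys [2, 1, 3]" "\<And>v. v \<in> set ys \<Longrightarrow> x < v"
  shows "contains_pattern (xs @ x # ys) [1, 3, 2, 4]"
proof -
  obtain a b c where "a < b" "b < c" "c < length ys" "ys ! b < ys ! a" "ys ! a < ys ! c"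
    using assms(1) unfolding contains_pattern_213_iff by blast
  then show ?thesis
    unfolding contains_pattern_1324_iff using assms(2)
    by (intro exI[of _ "length xs"] exI[of _ "length xs + Suc a"] exI[of _ "length xs + Suc b"]
        exI[of _ "length xs + Suc c"]) (auto simp: nth_append)
qed

text \<open>
  The inversions involve at most two positions each, too few to cover the whole list.
\<close>

lemma exists_position_without_inversion:
  assumes "2 * card (inversions p) < length p"
  obtains i where "i < length p" "\<And>j. (i, j) \<notin> inversions p" "\<And>j. (j, i) \<notin> inversions p"
proof -
  let ?I = "fst ` inversions p \<union> snd ` inversions p"
  have "card ?I \<le> card (fst ` inversions p) + card (snd ` inversions p)" by (rule card_Un_le)
  also have "\<dots> \<le> card (inversions p) + card (inversions p)"
    by (intro add_mono card_image_le) auto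
  finally have "card ?I < card {..<length p}" using assms by simp
  then have "\<not> {..<length p} \<subseteq> ?I" using card_mono[of ?I "{..<length p}"] by auto
  then obtain i where "i < length p" "i \<notin> ?I" by auto
  then show thesis using that by force
qed

lemma split_at_position_without_inversion:
  assumes "distinct p" "2 * card (inversions p) < length p"
  obtains xs x ys where "p = xs @ x # ys" "\<And>v. v \<in> set xs \<Longrightarrow> v < x" "\<And>v. v \<in> set ys \<Longrightarrow> x < v"
proof -
  obtain i where i: "i < length p" "\<And>j. (i, j) \<notin> inversions p" "\<And>j. (j, i) \<notin> inversions p"
    using exists_position_without_inversion[OF assms(2)] by blast
  show thesis
  proof
    show "p = take i p @ p ! i # drop (Suc i) p" using i by (simp add: id_take_nth_drop)
    fix v
    show "v < p ! i" if "v \<in> set (take i p)"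
    proof -
      obtain j where "j < i" "p ! j = v" using \<open>v \<in> _\<close> i by (auto simp: in_set_conv_nth)
      moreover from this have "p ! j \<noteq> p ! i" using i assms(1) by (subst nth_eq_iff_index_eq) auto
      ultimately show ?thesis using i(1) i(3)[of j] by (auto simp: inversions_def)
    qed
    show "p ! i < v" if "v \<in> set (drop (Suc i) p)"
    proof -
      obtain l where "l < length p - Suc i" "p ! (Suc i + l) = v"
        using \<open>v \<in> _\<close> i by (auto simp: in_set_conv_nth)
      moreover from this have "p ! (Suc i + l) \<noteq> p ! i"
        using i assms(1) by (subst nth_eq_iff_index_eq) auto
      ultimately show ?thesis using i(2)[of "Suc i + l"] by (auto simp: inversions_def)
    qed
  qed
qed

text \<open>
  The parts around an entry \<open>x\<close> without inversions have the value sets \<open>{1..<x}\<close> and \<open>{x<..N}\<close>, so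
  \<open>x\<close> and the two parts range over independently bounded choices. A permutation with several such
  entries is counted repeatedly, which costs at most a factor \<open>N\<close>.
\<close>

lemma num_avoiders_1324_inv_le_convolution:
  assumes "2 * k < N"
  shows "num_avoiders_inv [1, 3, 2, 4] N k \<le>
    (\<Sum>x=1..N. \<Sum>a\<le>k. card (decreasing_seqs (x - 1) a) * card (decreasing_seqs (N - x) (k - a)))"
proof -
  let ?T = "\<lambda>x a. (\<lambda>(xs, ys). xs @ x # ys) ` (avoiders_132_inv {1..<x} a \<times> avoiders_213_inv {x<..N} (k - a))"
  have "{p \<in> avoiders [1, 3, 2, 4] N. card (inversions p) = k} \<subseteq> (\<Union>x\<in>{1..N}. \<Union>a\<in>{..k}. ?T x a)"
  proof
    fix p assume "p \<in> {p \<in> avoiders [1, 3, 2, 4] N. card (inversions p) = k}"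
    then have p: "set p = {1..N}" "distinct p" "\<not> contains_pattern p [1, 3, 2, 4]" "card (inversions p) = k"
      by (auto simp: avoiders_def permutations_of_set_def)
    then have "length p = N" using distinct_card[of p] by simp
    then obtain xs x ys where split: "p = xs @ x # ys"
      and below: "\<And>v. v \<in> set xs \<Longrightarrow> v < x" and above: "\<And>v. v \<in> set ys \<Longrightarrow> x < v"
      using split_at_position_without_inversion[of p] p assms by metis
    have x: "x \<in> {1..N}" using p split by auto
    have mem: "v \<in> {1..N} \<longleftrightarrow> v \<in> set xs \<or> v = x \<or> v \<in> set ys" for v
      unfolding p(1)[symmetric] split by auto
    have "v \<in> set xs \<longleftrightarrow> v \<in> {1..<x}" "v \<in> set ys \<longleftrightarrow> v \<in> {x<..N}" for v
      using mem[of v] below[of v] above[of v] x by auto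
    then have "set xs = {1..<x}" "set ys = {x<..N}" by blast+
    moreover have "card (inversions xs) + card (inversions ys) = k"
      using card_inversions_direct_sum[of xs x ys] p split below above by simp
    moreover have "\<not> contains_pattern xs [1, 3, 2]" "\<not> contains_pattern ys [2, 1, 3]"
      using p split below above contains_1324_if_prefix_132 contains_1324_if_suffix_213 by metis+
    ultimately have "xs \<in> avoiders_132_inv {1..<x} (card (inversions xs))"
      "ys \<in> avoiders_213_inv {x<..N} (k - card (inversions xs))" "card (inversions xs) \<le> k"
      using p split by (auto simp: avoiders_132_inv_def avoiders_213_inv_def permutations_of_set_def)
    then have "p \<in> ?T x (card (inversions xs))" unfolding split by (intro image_eqI[of _ _ "(xs, ys)"]) auto
    then show "p \<in> (\<Union>x\<in>{1..N}. \<Union>a\<in>{..k}. ?T x a)"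
      using x \<open>card (inversions xs) \<le> k\<close> by blast
  qed
  then have "num_avoiders_inv [1, 3, 2, 4] N k \<le> card (\<Union>x\<in>{1..N}. \<Union>a\<in>{..k}. ?T x a)"
    unfolding num_avoiders_inv_def by (intro card_mono) auto
  also have "\<dots> \<le> (\<Sum>x=1..N. \<Sum>a\<le>k. card (?T x a))"
    by (intro order_trans[OF card_UN_le] sum_mono card_UN_le) auto
  also have "\<dots> \<le> (\<Sum>x=1..N. \<Sum>a\<le>k. card (decreasing_seqs (x - 1) a) * card (decreasing_seqs (N - x) (k - a)))"
  proof (intro sum_mono)
    fix x a
    have "card (?T x a) \<le> card (avoiders_132_inv {1..<x} a) * card (avoiders_213_inv {x<..N} (k - a))"
      by (intro order_trans[OF card_image_le]) (auto simp: card_cartesian_product)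
    also have "\<dots> \<le> card (decreasing_seqs (x - 1) a) * card (decreasing_seqs (N - x) (k - a))"
      using card_avoiders_132_inv_le[of "{1..<x}" a] card_avoiders_213_inv_le[of "{x<..N}" "k - a"]
      by (intro mult_mono) auto
    finally show "card (?T x a) \<le> card (decreasing_seqs (x - 1) a) * card (decreasing_seqs (N - x) (k - a))" .
  qed
  finally show ?thesis .
qed

text \<open>
  Using the same \<open>t\<close> for both factors of the convolution makes the bound on each summand independent
  of how the \<open>k\<close> inversions are divided.
\<close>

lemma num_avoiders_1324_inv_le_exp:
  fixes t :: real
  assumes "2 * k < N" "0 < t"
  shows "real (num_avoiders_inv [1, 3, 2, 4] N k) \<le> real N * real (k + 1) * exp (real k * t + pi\<^sup>2 / (3 * t))"
proof -
  have "real (num_avoiders_inv [1, 3, 2, 4] N k) \<le> real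
    (\<Sum>x=1..N. \<Sum>a\<le>k. card (decreasing_seqs (x - 1) a) * card (decreasing_seqs (N - x) (k - a)))"
    using num_avoiders_1324_inv_le_convolution[OF assms(1)] by (simp only: of_nat_le_iff)
  also have "\<dots> = (\<Sum>x=1..N. \<Sum>a\<le>k.
      real (card (decreasing_seqs (x - 1) a)) * real (card (decreasing_seqs (N - x) (k - a))))"
    by simp
  also have "\<dots> \<le> (\<Sum>x=1..N. \<Sum>a\<le>k. exp (real k * t + pi\<^sup>2 / (3 * t)))"
  proof (intro sum_mono)
    fix x a assume "a \<in> {..k}"
    then have "exp (real a * t + pi\<^sup>2 / (6 * t)) * exp (real (k - a) * t + pi\<^sup>2 / (6 * t)) =
        exp (real k * t + pi\<^sup>2 / (3 * t))"
      using assms(2) by (simp add: exp_add[symmetric] of_nat_diff field_simps)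
    then show "real (card (decreasing_seqs (x - 1) a)) * real (card (decreasing_seqs (N - x) (k - a)))
        \<le> exp (real k * t + pi\<^sup>2 / (3 * t))"
      using card_decreasing_seqs_le[OF assms(2)]
      by (metis mult_mono exp_ge_zero of_nat_0_le_iff)
  qed
  also have "\<dots> = real N * real (k + 1) * exp (real k * t + pi\<^sup>2 / (3 * t))"
    by simp
  finally show ?thesis .
qed

section \<open>An upper bound on the number of 1324-avoiders\<close>

text \<open>
  The inversions and their mirror images are disjoint sets of pairs of positions.
\<close>

lemma two_card_inversions_le: "2 * card (inversions p) \<le> (length p)\<^sup>2"
proof -
  have "card (inversions p) + card (prod.swap ` inversions p) = card (inversions p \<union> prod.swap ` inversions p)"
  proof (rule card_Un_disjoint[symmetric])
    show "inversions p \<inter> prod.swap ` inversions p = {}" by (auto simp: inversions_def)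
  qed auto
  also have "\<dots> \<le> card ({..<length p} \<times> {..<length p})"
    by (intro card_mono) (auto simp: inversions_def)
  finally show ?thesis by (simp add: card_image power2_eq_square)
qed

lemma num_avoiders_eq_sum_inv:
  "num_avoiders \<tau> n = (\<Sum>k\<le>n\<^sup>2 div 2. num_avoiders_inv \<tau> n k)"
proof -
  have "avoiders \<tau> n = (\<Union>k\<le>n\<^sup>2 div 2. {p \<in> avoiders \<tau> n. card (inversions p) = k})"
  proof -
    have "card (inversions p) \<le> n\<^sup>2 div 2" if "p \<in> avoiders \<tau> n" for p
      using that two_card_inversions_le[of p]
      by (auto simp: avoiders_def length_finite_permutations_of_set)
    then show ?thesis by auto
  qed
  moreover have "finite (avoiders \<tau> n)" by (simp add: avoiders_def)
  ultimately show ?thesis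
    unfolding num_avoiders_def num_avoiders_inv_def
    by (subst \<open>avoiders \<tau> n = _\<close>, subst card_UN_disjoint) auto
qed

text \<open>
  This is where monotonicity in the length enters: the estimate for few inversions does not apply at
  length \<open>n\<close> itself, but it does at length \<open>n\<^sup>2 + 1\<close>, which exceeds \<open>2k\<close> for every \<open>k\<close> that
  occurs.
\<close>

lemma num_avoiders_1324_le:
  assumes mono: "\<And>n k. num_avoiders_inv [1, 3, 2, 4] n k \<le> num_avoiders_inv [1, 3, 2, 4] (n + 1) k"
    and "1 \<le> n"
  shows "real (num_avoiders [1, 3, 2, 4] n) \<le> (real n ^ 2 + 1) ^ 3 * exp (real n * (pi * sqrt (2 / 3)))"
proof -
  define N where "N = n\<^sup>2 + 1"
  \<comment> \<open>This \<open>t\<close> minimises \<open>k t + pi\<^sup>2 / (3 t)\<close> at the extreme value \<open>k = n\<^sup>2 / 2\<close>; both terms are then equal.\<close>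
  define t where "t = pi * sqrt (2 / 3) / real n"
  have t: "0 < t" using assms(2) by (simp add: t_def)
  have sq: "sqrt (2 / 3) * sqrt (2 / 3) = 2 / (3 :: real)" by simp
  have "pi\<^sup>2 / (3 * t) = real n * pi / (3 * sqrt (2 / 3))"
    using assms(2) by (simp add: t_def power2_eq_square field_simps)
  also have "\<dots> = real n * pi * sqrt (2 / 3) / 2"
    using sq by (simp add: field_simps)
  finally have t2: "pi\<^sup>2 / (3 * t) = real n * (pi * sqrt (2 / 3)) / 2" by simp
  have "n \<le> N" unfolding N_def using self_le_power[of n 2] assms(2) by simp
  have bound: "real (num_avoiders_inv [1, 3, 2, 4] n k) \<le>
      real N * real N * exp (real n * (pi * sqrt (2 / 3)))" if "k \<le> n\<^sup>2 div 2" for k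
  proof -
    have "2 * k \<le> n\<^sup>2" using that by simp
    then have k: "2 * real k \<le> real n ^ 2" by (metis of_nat_le_iff of_nat_mult of_nat_numeral of_nat_power)
    have "real k * t \<le> real n ^ 2 / 2 * t" using k t by (intro mult_right_mono) auto
    also have "\<dots> = real n * (pi * sqrt (2 / 3)) / 2"
      using assms(2) by (simp add: t_def power2_eq_square)
    finally have expo: "real k * t + pi\<^sup>2 / (3 * t) \<le> real n * (pi * sqrt (2 / 3))" using t2 by simp
    have "num_avoiders_inv [1, 3, 2, 4] n k \<le> num_avoiders_inv [1, 3, 2, 4] N k"
      by (rule lift_Suc_mono_le[of "\<lambda>n. num_avoiders_inv [1, 3, 2, 4] n k", OF _ \<open>n \<le> N\<close>])
        (use mono[of _ k] in simp)
    then have "real (num_avoiders_inv [1, 3, 2, 4] n k) \<le> real (num_avoiders_inv [1, 3, 2, 4] N k)" by simp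
    also have "\<dots> \<le> real N * real (k + 1) * exp (real k * t + pi\<^sup>2 / (3 * t))"
      using \<open>2 * k \<le> n\<^sup>2\<close> t by (intro num_avoiders_1324_inv_le_exp) (auto simp: N_def)
    also have "\<dots> \<le> real N * real N * exp (real n * (pi * sqrt (2 / 3)))"
      using expo \<open>2 * k \<le> n\<^sup>2\<close> by (intro mult_mono) (auto simp: N_def)
    finally show ?thesis .
  qed
  have "real (num_avoiders [1, 3, 2, 4] n) = (\<Sum>k\<le>n\<^sup>2 div 2. real (num_avoiders_inv [1, 3, 2, 4] n k))"
    by (simp add: num_avoiders_eq_sum_inv)
  also have "\<dots> \<le> (\<Sum>k\<le>n\<^sup>2 div 2. real N * real N * exp (real n * (pi * sqrt (2 / 3))))"
    using bound by (intro sum_mono) auto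
  also have "\<dots> = real (n\<^sup>2 div 2 + 1) * (real N * real N * exp (real n * (pi * sqrt (2 / 3))))"
    by simp
  also have "\<dots> \<le> real N * (real N * real N * exp (real n * (pi * sqrt (2 / 3))))"
    by (intro mult_right_mono) (auto simp: N_def)
  also have "\<dots> = (real n ^ 2 + 1) ^ 3 * exp (real n * (pi * sqrt (2 / 3)))"
    by (simp add: N_def power3_eq_cube add_ac)
  finally show ?thesis .
qed

section \<open>Skew sums\<close>

text \<open>
  An occurrence of 1324 ends above where it starts, so it cannot start in the upper block \<open>p\<close> and end
  in the lower block \<open>q\<close>. Hence it lies inside one block.
\<close>

lemma skew_sum_avoids_1324:
  assumes "\<not> contains_pattern p [1, 3, 2, 4]" "\<not> contains_pattern q [1, 3, 2, 4]"
    and "\<And>x y. x \<in> set p \<Longrightarrow> y \<in> set q \<Longrightarrow> y < x"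
  shows "\<not> contains_pattern (p @ q) [1, 3, 2, 4]"
proof
  assume "contains_pattern (p @ q) [1, 3, 2, 4]"
  then obtain a b c d where abcd: "a < b" "b < c" "c < d" "d < length p + length q"
      "(p @ q) ! a < (p @ q) ! c" "(p @ q) ! c < (p @ q) ! b" "(p @ q) ! b < (p @ q) ! d"
    unfolding contains_pattern_1324_iff by auto
  show False
  proof (cases "a < length p")
    case True
    have "d < length p"
    proof (rule ccontr)
      assume "\<not> d < length p"
      then have "(p @ q) ! a \<in> set p" "(p @ q) ! d \<in> set q"
        using True abcd by (auto simp: nth_append)
      then have "(p @ q) ! d < (p @ q) ! a" by (rule assms(3))
      then show False using abcd by linarith
    qed
    then have "contains_pattern p [1, 3, 2, 4]"
      unfolding contains_pattern_1324_iff using abcd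
      by (intro exI[of _ a] exI[of _ b] exI[of _ c] exI[of _ d]) (auto simp: nth_append)
    then show False using assms by simp
  next
    case False
    then have "contains_pattern q [1, 3, 2, 4]"
      unfolding contains_pattern_1324_iff using abcd
      by (intro exI[of _ "a - length p"] exI[of _ "b - length p"] exI[of _ "c - length p"]
          exI[of _ "d - length p"]) (auto simp: nth_append)
    then show False using assms by simp
  qed
qed

lemma contains_pattern_map_strict_mono:
  assumes "strict_mono f"
  shows "contains_pattern (map f p) \<tau> \<longleftrightarrow> contains_pattern p \<tau>"
proof -
  have "order_isomorphic (map (\<lambda>i. map f p ! i) is) \<tau> \<longleftrightarrow> order_isomorphic (map (\<lambda>i. p ! i) is) \<tau>"
    if "set is \<subseteq> {..<length p}" for "is"
  proof -
    have "is ! i < length p" if "i < length is" for i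
      using that \<open>set is \<subseteq> _\<close> nth_mem by blast
    then show ?thesis
      by (auto simp: order_isomorphic_def strict_mono_less[OF assms])
  qed
  then show ?thesis unfolding contains_pattern_def length_map by blast
qed

lemma num_avoiders_1324_supermultiplicative:
  "num_avoiders [1, 3, 2, 4] m * num_avoiders [1, 3, 2, 4] n \<le> num_avoiders [1, 3, 2, 4] (m + n)"
proof -
  let ?S = "avoiders [1, 3, 2, 4]"
  let ?f = "\<lambda>(p, q). map ((+) n) p @ q"
  have "card (?S m \<times> ?S n) \<le> card (?S (m + n))"
  proof (rule card_inj_on_le)
    show "inj_on ?f (?S m \<times> ?S n)"
      by (auto simp: inj_on_def avoiders_def length_finite_permutations_of_set inj_map_eq_map)
    show "?f ` (?S m \<times> ?S n) \<subseteq> ?S (m + n)"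
    proof (clarify)
      fix p q assume "p \<in> ?S m" "q \<in> ?S n"
      then have pq: "set p = {1..m}" "distinct p" "\<not> contains_pattern p [1, 3, 2, 4]"
        "set q = {1..n}" "distinct q" "\<not> contains_pattern q [1, 3, 2, 4]"
        by (auto simp: avoiders_def permutations_of_set_def)
      have "(+) n ` {1..m} \<union> {1..n} = {1..m + n}"
        by (auto simp: image_add_atLeastAtMost)
      then have "map ((+) n) p @ q \<in> permutations_of_set {1..m + n}"
        using pq by (auto simp: permutations_of_set_def distinct_map)
      moreover have "\<not> contains_pattern (map ((+) n) p @ q) [1, 3, 2, 4]"
      proof (rule skew_sum_avoids_1324)
        show "\<not> contains_pattern (map ((+) n) p) [1, 3, 2, 4]"
          using pq by (subst contains_pattern_map_strict_mono) (auto intro: strict_monoI)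
      qed (use pq in auto)
      ultimately show "map ((+) n) p @ q \<in> ?S (m + n)" by (simp add: avoiders_def)
    qed
  qed (simp add: avoiders_def)
  then show ?thesis by (simp add: num_avoiders_def card_cartesian_product)
qed

text \<open>
  Supplies the logarithms below with positive arguments; the identity permutation is a witness.
\<close>

lemma num_avoiders_1324_pos: "0 < num_avoiders [1, 3, 2, 4] n"
proof -
  have "[1..<Suc n] \<in> avoiders [1, 3, 2, 4] n"
    unfolding avoiders_def contains_pattern_1324_iff permutations_of_set_def
    by (auto simp del: upt_Suc)
  then show ?thesis
    unfolding num_avoiders_def by (subst card_gt_0_iff) (auto simp: avoiders_def)
qed

section \<open>Superadditive sequences\<close>

lemma superadditive_multiple_le:
  fixes f :: "nat \<Rightarrow> real"
  assumes "\<And>m n. f m + f n \<le> f (m + n)" "\<And>n. 0 \<le> f n"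
  shows "real k * f m \<le> f (k * m)"
proof (induction k)
  case 0
  then show ?case using assms(2) by simp
next
  case (Suc k)
  then show ?case using assms(1)[of m "k * m"] by (simp add: algebra_simps)
qed

text \<open>
  Fekete's lemma for nonnegative sequences. Writing \<open>n = q * m + r\<close> with \<open>r < m\<close> gives
  \<open>f n \<ge> q * f m\<close>, and \<open>q * m / n\<close> tends to 1, so \<open>f n / n\<close> is eventually above every number
  below \<open>f m / m\<close>.
\<close>

lemma superadditive_tendsto_Sup:
  fixes f :: "nat \<Rightarrow> real"
  assumes super: "\<And>m n. f m + f n \<le> f (m + n)" and nonneg: "\<And>n. 0 \<le> f n"
    and bdd: "bdd_above ((\<lambda>n. f n / real n) ` {1..})"
  shows "(\<lambda>n. f n / real n) \<longlonglongrightarrow> (SUP n\<in>{1..}. f n / real n)"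
proof (rule order_tendstoI)
  let ?L = "SUP n\<in>{1..}. f n / real n"
  fix u assume "?L < u"
  have "eventually (\<lambda>n. 1 \<le> n) sequentially" by (rule eventually_ge_at_top)
  then show "eventually (\<lambda>n. f n / real n < u) sequentially"
  proof eventually_elim
    case (elim n)
    then have "f n / real n \<le> ?L" by (intro cSUP_upper bdd) auto
    then show ?case using \<open>?L < u\<close> by simp
  qed
next
  let ?L = "SUP n\<in>{1..}. f n / real n"
  fix l assume "l < ?L"
  then obtain m where m: "1 \<le> m" "l < f m / real m"
    using less_cSUP_iff[OF _ bdd, of l] by auto
  have "(\<lambda>n. (1 - real m / real n) * (f m / real m)) \<longlonglongrightarrow> (1 - 0) * (f m / real m)"
    by (intro tendsto_intros lim_const_over_n)
  then have "eventually (\<lambda>n. l < (1 - real m / real n) * (f m / real m)) sequentially"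
    using m by (intro order_tendstoD) auto
  moreover have "eventually (\<lambda>n. 1 \<le> n) sequentially" by (rule eventually_ge_at_top)
  ultimately show "eventually (\<lambda>n. l < f n / real n) sequentially"
  proof eventually_elim
    case (elim n)
    have "n - m \<le> n div m * m"
      using m by (metis add.commute div_mult_mod_eq le_diff_conv less_imp_le_nat mod_less_divisor
          nat_add_left_cancel_le less_le_trans zero_less_one)
    then have "real n - real m \<le> real (n div m) * real m"
      by (metis of_nat_mult of_nat_diff of_nat_le_iff nat_le_linear diff_le_0_iff_le of_nat_0_le_iff order_trans)
    then have "(real n - real m) * (f m / real m) \<le> real (n div m) * real m * (f m / real m)"
      using nonneg by (intro mult_right_mono) auto
    also have "\<dots> = real (n div m) * f m" using m by simp
    also have "\<dots> \<le> f (n div m * m)" by (intro superadditive_multiple_le super nonneg)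
    also have "\<dots> \<le> f n"
      using super[of "n div m * m" "n mod m"] nonneg[of "n mod m"] by simp
    finally have "(real n - real m) * (f m / real m) / real n \<le> f n / real n"
      by (rule divide_right_mono) simp
    moreover have "(real n - real m) * (f m / real m) / real n = (1 - real m / real n) * (f m / real m)"
      using elim(2) by (simp add: field_simps)
    ultimately show ?case using elim(1) by linarith
  qed
qed

text \<open>
  For a superadditive sequence an asymptotic bound on the rate is a bound at every index: the rate at
  \<open>m\<close> is at most the rate at every multiple of \<open>m\<close>. This removes the polynomial factor in the bound
  on the number of avoiders.
\<close>

lemma superadditive_rate_le:
  fixes f :: "nat \<Rightarrow> real"
  assumes super: "\<And>m n. f m + f n \<le> f (m + n)" and nonneg: "\<And>n. 0 \<le> f n"
    and le: "\<And>n. 1 \<le> n \<Longrightarrow> f n / real n \<le> g n" and lim: "g \<longlonglongrightarrow> c" and "1 \<le> m"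
  shows "f m / real m \<le> c"
proof (rule LIMSEQ_le_const)
  show "(\<lambda>k. g (Suc k * m)) \<longlonglongrightarrow> c"
    using \<open>1 \<le> m\<close> by (intro LIMSEQ_subseq_LIMSEQ[OF lim, unfolded comp_def] strict_monoI) auto
  have "f m / real m \<le> g (Suc k * m)" for k
  proof -
    have "f m / real m = real (Suc k) * f m / real (Suc k * m)"
      by (simp only: of_nat_mult) (simp del: of_nat_Suc)
    also have "\<dots> \<le> f (Suc k * m) / real (Suc k * m)"
      by (intro divide_right_mono superadditive_multiple_le super nonneg) auto
    also have "\<dots> \<le> g (Suc k * m)" using \<open>1 \<le> m\<close> by (intro le) auto
    finally show ?thesis .
  qed
  then show "\<exists>N. \<forall>k\<ge>N. f m / real m \<le> g (Suc k * m)" by blast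
qed

section \<open>The Stanley-Wilf limit\<close>

theorem theorem17:
  assumes "\<And>n k :: nat. num_avoiders_inv [1, 3, 2, 4] n k \<le> num_avoiders_inv [1, 3, 2, 4] (n + 1) k"
  shows "stanley_wilf_limit [1, 3, 2, 4] \<le> exp (pi * sqrt (2 / 3))"
proof -
  define S where "S n = num_avoiders [1, 3, 2, 4] n" for n
  define f where "f n = ln (real (S n))" for n
  define C where "C = pi * sqrt (2 / 3)"
  have S_pos: "0 < S n" for n unfolding S_def by (rule num_avoiders_1324_pos)
  have nonneg: "0 \<le> f n" for n using S_pos[of n] by (simp add: f_def Suc_le_eq)
  have super: "f m + f n \<le> f (m + n)" for m n
  proof -
    have "f m + f n = ln (real (S m * S n))" using S_pos by (simp add: f_def ln_mult)
    also have "\<dots> \<le> f (m + n)"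
      unfolding f_def using S_pos num_avoiders_1324_supermultiplicative[of m n]
      by (subst ln_le_cancel_iff) (auto simp: S_def simp del: of_nat_mult)
    finally show ?thesis .
  qed
  have le: "f n / real n \<le> 3 * ln (real n ^ 2 + 1) / real n + C" if "1 \<le> n" for n
  proof -
    have "f n \<le> ln ((real n ^ 2 + 1) ^ 3 * exp (real n * C))"
      unfolding f_def using num_avoiders_1324_le[OF assms that] S_pos[of n]
      by (subst ln_le_cancel_iff) (auto simp: S_def C_def intro!: mult_pos_pos zero_less_power add_nonneg_pos)
    also have "\<dots> = 3 * ln (real n ^ 2 + 1) + real n * C"
      by (subst ln_mult_pos) (auto simp: ln_realpow add_nonneg_pos)
    finally have "f n / real n \<le> (3 * ln (real n ^ 2 + 1) + real n * C) / real n"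
      by (rule divide_right_mono) simp
    then show ?thesis using that by (simp add: add_divide_distrib)
  qed
  have lim: "(\<lambda>n. 3 * ln (real n ^ 2 + 1) / real n + C) \<longlonglongrightarrow> C" by real_asymp
  have rate: "f n / real n \<le> C" if "1 \<le> n" for n
    using superadditive_rate_le[OF super nonneg le lim that] .
  define L where "L = (SUP n\<in>{1..}. f n / real n)"
  have "(\<lambda>n. f n / real n) \<longlonglongrightarrow> L"
    unfolding L_def using rate by (intro superadditive_tendsto_Sup super nonneg bdd_aboveI2) auto
  then have "(\<lambda>n. exp (f n / real n)) \<longlonglongrightarrow> exp L" by (rule tendsto_exp)
  moreover have "eventually (\<lambda>n. exp (f n / real n) = root n (real (S n))) sequentially"
    using eventually_gt_at_top[of 0]
  proof eventually_elim
    case (elim n)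
    have "exp (f n / real n) = root n (exp (f n))"
      using elim by (intro real_root_pos_unique[symmetric]) (auto simp: exp_of_nat_mult[symmetric])
    then show ?case using S_pos[of n] by (simp add: f_def)
  qed
  ultimately have "(\<lambda>n. root n (real (S n))) \<longlonglongrightarrow> exp L"
    by (rule Lim_transform_eventually)
  then have "stanley_wilf_limit [1, 3, 2, 4] = exp L"
    unfolding stanley_wilf_limit_def S_def by (rule limI)
  moreover have "L \<le> C"
    unfolding L_def using rate by (intro cSUP_least) auto
  ultimately show ?thesis by (simp add: C_def)
qed

end
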